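(* For every $n\in\mathbb{N}$ the following relations hold in $U$: $$[(xxyy)^n,x]_{q^2}=(q^2-q^{-2})(xxyy)^nx,$$ $$[x,(yyxx)^n]_{q^2}=(q^2-q^{-2})x(yyxx)^n,$$ $$[x,(xxyy)^nxx]=0,$$ $$[(yyxx)^nyy,x]=(1-q^{-4})\left((yyxx)^nyyx-xyy(xxyy)^n\right).$$
   Context: Let $\mathbb{F}$ be a field of characteristic zero and let $q\in\mathbb{F}$ be nonzero and not a root of unity; $\mathbb{N}=\{0,1,2,\ldots\}$. Let $\mathbb{V}$ be the free associative unital $\mathbb{F}$-algebra on two noncommuting generators (letters) $x,y$; the words in $x,y$ (including the trivial word $\mathbf{1}$) form a basis of $\mathbb{V}$. Words such as $(xxyy)^nx$ are written with respect to the free (concatenation) product. The $q$-shuffle product $\star$ on the vector space $\mathbb{V}$ is the bilinear associative product with unit $\mathbf{1}$ determined as follows. Put $\langle x,x\rangle=\langle y,y\rangle=2$ and $\langle x,y\rangle=\langle y,x\rangle=-2$. For nontrivial words $u=u_1\cdots u_r$ and $v=v_1\cdots v_s$, $$u\star v=u_1\big((u_2\cdots u_r)\star v\big)+v_1\big(u\star(v_2\cdots v_s)\big)q^{\langle v_1,u_1\rangle+\cdots+\langle v_1,u_r\rangle}.$$ $U$ denotes the subalgebra of $(\mathbb{V},\star)$ generated by $x,y$; all the words in the statement lie in $U$. Commutators are taken with respect to $\star$: $[X,Y]=X\star Y-Y\star X$ and $[X,Y]_{q^2}=q^2X\star Y-q^{-2}Y\star X$. *)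

theory Defs
  imports Complex_Main "HOL-Library.Poly_Mapping"
begin

datatype letter = X | Y

text \<open>
  The vector space \<open>\<bbbV>\<close> consists of the finitely supported functions on words.  The product that
  the library puts on \<open>\<Rightarrow>\<^sub>0\<close> needs keys in an additive monoid, which lists are not, so the
  free product and the \<open>q\<close>-shuffle product are bilinear extensions of products of words.
\<close>

type_synonym 'a tensor = "letter list \<Rightarrow>\<^sub>0 'a"

definition word :: "letter list \<Rightarrow> 'a::field tensor" where
  "word w = Poly_Mapping.single w 1"

definition scale :: "'a::field \<Rightarrow> 'a tensor \<Rightarrow> 'a tensor" where
  "scale c f = Poly_Mapping.map (\<lambda>a. c * a) f"

definition bilinear_ext ::
    "(letter list \<Rightarrow> letter list \<Rightarrow> 'a::field tensor) \<Rightarrow> 'a tensor \<Rightarrow> 'a tensor \<Rightarrow> 'a tensor" where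
  "bilinear_ext m f g =
     (\<Sum>u\<in>Poly_Mapping.keys f. \<Sum>v\<in>Poly_Mapping.keys g.
        scale (Poly_Mapping.lookup f u * Poly_Mapping.lookup g v) (m u v))"

definition free_product :: "'a::field tensor \<Rightarrow> 'a tensor \<Rightarrow> 'a tensor" where
  "free_product = bilinear_ext (\<lambda>u v. word (u @ v))"

fun pairing :: "letter \<Rightarrow> letter \<Rightarrow> int" where
  "pairing X X = 2"
| "pairing Y Y = 2"
| "pairing X Y = -2"
| "pairing Y X = -2"

fun qshuffle_words :: "'a::field \<Rightarrow> letter list \<Rightarrow> letter list \<Rightarrow> 'a tensor" where
  "qshuffle_words q [] v = word v"
| "qshuffle_words q (a # u) [] = word (a # u)"
| "qshuffle_words q (a # u) (b # v) =
     free_product (word [a]) (qshuffle_words q u (b # v)) +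
     scale (q powi (\<Sum>c\<leftarrow>a # u. pairing b c)) (free_product (word [b]) (qshuffle_words q (a # u) v))"

definition qshuffle :: "'a::field \<Rightarrow> 'a tensor \<Rightarrow> 'a tensor \<Rightarrow> 'a tensor" where
  "qshuffle q = bilinear_ext (qshuffle_words q)"

inductive_set U :: "'a::field \<Rightarrow> 'a tensor set" for q :: 'a where
  one: "word [] \<in> U q"
| gen_x: "word [X] \<in> U q"
| gen_y: "word [Y] \<in> U q"
| add: "f \<in> U q \<Longrightarrow> g \<in> U q \<Longrightarrow> f + g \<in> U q"
| scale: "f \<in> U q \<Longrightarrow> scale c f \<in> U q"
| mult: "f \<in> U q \<Longrightarrow> g \<in> U q \<Longrightarrow> qshuffle q f g \<in> U q"

definition comm :: "'a::field \<Rightarrow> 'a tensor \<Rightarrow> 'a tensor \<Rightarrow> 'a tensor" where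
  "comm q f g = qshuffle q f g - qshuffle q g f"

text \<open>\<open>qcomm q r f g\<close> is \<open>[f, g]\<^sub>r\<close> for the \<open>q\<close>-shuffle product.\<close>

definition qcomm :: "'a::field \<Rightarrow> 'a \<Rightarrow> 'a tensor \<Rightarrow> 'a tensor \<Rightarrow> 'a tensor" where
  "qcomm q r f g = scale r (qshuffle q f g) - scale (inverse r) (qshuffle q g f)"

definition xxyy :: "nat \<Rightarrow> letter list" where
  "xxyy n = concat (replicate n [X, X, Y, Y])"

definition yyxx :: "nat \<Rightarrow> letter list" where
  "yyxx n = concat (replicate n [Y, Y, X, X])"

end

theory Submission
  imports Defs
begin

text \<open>
  The letters of a doubly alternating word repeat the pattern \<open>xxyy\<close> cyclically. Multiplying such a
  word \<open>w\<close> by a letter \<open>c\<close> inserts \<open>c\<close> at every position, with a power of \<open>q\<close> that depends on the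
  position. In a suitable combination of \<open>w \<star> c\<close> and \<open>c \<star> w\<close> the insertions between two equal
  letters get coefficient zero and the insertions before and after \<open>cc\<close> cancel, so that only those
  at the two ends of \<open>w\<close> survive. This gives all the relations.

  It also gives membership in \<open>U\<close> by induction on the length, except that for length \<open>4k\<close> it only
  shows that the four words of that length are congruent modulo \<open>U\<close>. There the antipode identity
  \<open>\<Sum> (-1)\<^bsup>|u|\<^esup> q\<^bsup>c(u)\<^esup> rev(u) \<star> v = 0\<close>, summed over the factorizations \<open>w = uv\<close>, shows
  \<open>w + q\<^bsup>c\<^esup> rev(w) \<in> U\<close>, hence \<open>(1 + q\<^bsup>c\<^esup>) w \<in> U\<close>.
\<close>

section \<open>The vector space of tensors\<close>

lemma lookup_scale [simp]: "Poly_Mapping.lookup (scale c f) w = c * Poly_Mapping.lookup f w"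
  by (simp add: scale_def Poly_Mapping.map.rep_eq when_def)

interpretation tensor: vector_space scale
  by unfold_locales (auto intro!: poly_mapping_eqI simp: lookup_add algebra_simps)

text \<open>Enlarging the index set beyond the support gives two tensors a common one, as additivity
  requires.\<close>

lemma bilinear_ext_word_left:
  assumes "finite S" "Poly_Mapping.keys g \<subseteq> S"
  shows "bilinear_ext m (word u) g = (\<Sum>v\<in>S. scale (Poly_Mapping.lookup g v) (m u v))"
proof -
  have "bilinear_ext m (word u) g
      = (\<Sum>v\<in>Poly_Mapping.keys g. scale (Poly_Mapping.lookup g v) (m u v))"
    by (simp add: bilinear_ext_def word_def)
  also have "\<dots> = (\<Sum>v\<in>S. scale (Poly_Mapping.lookup g v) (m u v))"
    using assms by (intro sum.mono_neutral_left) (auto simp: in_keys_iff)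
  finally show ?thesis .
qed

lemma bilinear_ext_word [simp]: "bilinear_ext m (word u) (word v) = m u v"
  by (simp add: bilinear_ext_def word_def)

lemma bilinear_ext_word_add:
  "bilinear_ext m (word u) (f + g) = bilinear_ext m (word u) f + bilinear_ext m (word u) g"
proof -
  let ?S = "Poly_Mapping.keys f \<union> Poly_Mapping.keys g"
  have "Poly_Mapping.keys (f + g) \<subseteq> ?S" by (rule Poly_Mapping.keys_add)
  then show ?thesis
    by (simp add: bilinear_ext_word_left[where S = ?S] lookup_add tensor.scale_left_distrib
        sum.distrib)
qed

lemma bilinear_ext_word_scale:
  "bilinear_ext m (word u) (scale c f) = scale c (bilinear_ext m (word u) f)"
proof -
  have "Poly_Mapping.keys (scale c f) \<subseteq> Poly_Mapping.keys f" by (auto simp: in_keys_iff)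
  then show ?thesis
    by (simp add: bilinear_ext_word_left[where S = "Poly_Mapping.keys f"] tensor.scale_sum_right)
qed

definition prepend :: "letter \<Rightarrow> 'a::field tensor \<Rightarrow> 'a tensor" where
  "prepend a = free_product (word [a])"

lemma prepend_word [simp]: "prepend a (word w) = word (a # w)"
  by (simp add: prepend_def free_product_def)

lemma prepend_add [simp]: "prepend a (f + g) = prepend a f + prepend a g"
  by (simp add: prepend_def free_product_def bilinear_ext_word_add)

lemma prepend_scale [simp]: "prepend a (scale c f) = scale c (prepend a f)"
  by (simp add: prepend_def free_product_def bilinear_ext_word_scale)

lemma prepend_0 [simp]: "prepend a 0 = 0"
  using prepend_scale[of a 0 0] by simp

lemma prepend_diff [simp]: "prepend a (f - g) = prepend a f - prepend a g"
  using prepend_add[of a "f - g" g] by simp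

lemma qshuffle_word [simp]: "qshuffle q (word u) (word v) = qshuffle_words q u v"
  by (simp add: qshuffle_def)

lemma qshuffle_words_Cons_Cons:
  "qshuffle_words q (a # u) (b # v) = prepend a (qshuffle_words q u (b # v)) +
     scale (q powi (\<Sum>c\<leftarrow>a # u. pairing b c)) (prepend b (qshuffle_words q (a # u) v))"
  by (simp add: prepend_def)

lemma qshuffle_words_Nil_right [simp]: "qshuffle_words q u [] = word u"
  by (cases u) auto

declare qshuffle_words.simps(3) [simp del]

lemma pairing_commute: "pairing a b = pairing b a"
  by (cases a; cases b) auto

section \<open>The antipode identity\<close>

text \<open>The sum over the factorizations \<open>v = v\<^sub>1v\<^sub>2\<close> of \<open>\<plusminus> q\<^bsup>c\<^esup> (rev(v\<^sub>1) u) \<star> v\<^sub>2\<close>.\<close>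

fun antipode_sum :: "'a::field \<Rightarrow> letter list \<Rightarrow> letter list \<Rightarrow> 'a tensor" where
  "antipode_sum q u [] = word u"
| "antipode_sum q u (b # v) = qshuffle_words q u (b # v) -
     scale (q powi (\<Sum>c\<leftarrow>u. pairing b c)) (antipode_sum q (b # u) v)"

text \<open>Telescoping: by induction the tail of the sum is exactly the second term of the shuffle
  recursion, so only the term beginning with \<open>a\<close> remains.\<close>

lemma antipode_sum_Cons: "antipode_sum q (a # u) v = prepend a (qshuffle_words q u v)"
  by (induction v arbitrary: a u) (simp_all add: qshuffle_words_Cons_Cons)

lemma U_0: "0 \<in> U q"
  using U.scale[OF U.one, of 0] by simp

lemma U_diff: "f \<in> U q \<Longrightarrow> g \<in> U q \<Longrightarrow> f - g \<in> U q"
  using U.add[OF _ U.scale[of g q "-1"], of f] by simp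

lemma U_scale_cancel:
  assumes "scale c f \<in> U q" "c \<noteq> 0"
  shows "f \<in> U q"
  using U.scale[OF assms(1), of "inverse c"] assms(2) by simp

text \<open>Every product in the sum has both factors in \<open>U q\<close> except the last one,
  whose right factor is empty; that one is the reversed word times a sign and a power of
  \<open>q\<close>.\<close>

lemma antipode_sum_in_U:
  assumes q: "q \<noteq> 0"
    and "\<And>k. k < length v \<Longrightarrow> word (rev (take k v) @ u) \<in> U q \<and> word (drop k v) \<in> U q"
  shows "\<exists>c::int. antipode_sum q u v - scale ((-1) ^ length v * q powi c) (word (rev v @ u)) \<in> U q"
  using assms(2)
proof (induction v arbitrary: u)
  case Nil
  have "antipode_sum q u [] - scale ((-1) ^ length [] * q powi 0) (word (rev [] @ u)) = 0"
    by simp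
  then show ?case using U_0 by metis
next
  case (Cons b v)
  have "word (rev (take k v) @ (b # u)) \<in> U q \<and> word (drop k v) \<in> U q" if "k < length v" for k
    using Cons.prems[of "Suc k"] that by simp
  from Cons.IH[OF this] obtain c :: int where
    c: "antipode_sum q (b # u) v - scale ((-1) ^ length v * q powi c) (word (rev v @ b # u)) \<in> U q"
    by blast
  have prod: "qshuffle_words q u (b # v) \<in> U q"
    using U.mult[of "word u" q "word (b # v)"] Cons.prems[of 0] by simp
  define e where "e = (\<Sum>c\<leftarrow>u. pairing b c)"
  have *: "qshuffle_words q u (b # v) - scale (q powi e)
      (antipode_sum q (b # u) v - scale ((-1) ^ length v * q powi c) (word (rev v @ b # u))) \<in> U q"
    by (intro U_diff U.scale prod c)
  have "antipode_sum q u (b # v) -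
      scale ((-1) ^ length (b # v) * q powi (e + c)) (word (rev (b # v) @ u)) \<in> U q"
    using * q by (simp add: e_def[symmetric] tensor.scale_right_diff_distrib
        power_int_add algebra_simps)
  then show ?case by blast
qed

text \<open>For \<open>w = b # v\<close> the antipode sum started at \<open>[b]\<close> collapses to
  \<open>w\<close>. Its last term is \<open>rev w\<close> with the sign of an odd number of
  letters.\<close>

lemma word_plus_rev_in_U:
  assumes "q \<noteq> 0"
    and "\<And>k. 0 < k \<Longrightarrow> k < length w \<Longrightarrow> word (rev (take k w)) \<in> U q \<and> word (drop k w) \<in> U q"
    and "even (length w)" "w \<noteq> []"
  shows "\<exists>c::int. word w + scale (q powi c) (word (rev w)) \<in> U q"
proof -
  obtain b v where w: "w = b # v" using assms(4) by (cases w) auto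
  have "word (rev (take k v) @ [b]) \<in> U q \<and> word (drop k v) \<in> U q" if "k < length v" for k
    using assms(2)[of "Suc k"] that w by simp
  from antipode_sum_in_U[OF assms(1) this] obtain c :: int where
    "antipode_sum q [b] v - scale ((-1) ^ length v * q powi c) (word (rev v @ [b])) \<in> U q"
    by blast
  then show ?thesis
    using assms(3) w by (auto simp: antipode_sum_Cons)
qed

section \<open>Doubly alternating words\<close>

definition cyc :: "nat \<Rightarrow> letter" where
  "cyc i = (if i mod 4 < 2 then X else Y)"

definition daw :: "nat \<Rightarrow> nat \<Rightarrow> letter list" where
  "daw i n = map cyc [i..<i + n]"

lemma length_daw [simp]: "length (daw i n) = n"
  by (simp add: daw_def)

lemma daw_0 [simp]: "daw i 0 = []"
  by (simp add: daw_def)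

lemma daw_Suc: "daw i (Suc n) = cyc i # daw (Suc i) n"
  by (simp add: daw_def upt_conv_Cons del: upt_Suc)

lemma daw_Suc_right: "daw i (Suc n) = daw i n @ [cyc (i + n)]"
  by (simp add: daw_def)

lemma cyc_cong: "i mod 4 = j mod 4 \<Longrightarrow> cyc i = cyc j"
  by (simp add: cyc_def)

lemma daw_cong: "i mod 4 = j mod 4 \<Longrightarrow> daw i n = daw j n"
  by (auto simp: daw_def intro!: nth_equalityI cyc_cong mod_add_cong)

lemma nth_daw: "m < n \<Longrightarrow> daw i n ! m = cyc (i + m)"
  by (simp add: daw_def)

lemma take_daw: "k \<le> n \<Longrightarrow> take k (daw i n) = daw i k"
  by (simp add: daw_def take_map take_upt)

lemma drop_daw: "k \<le> n \<Longrightarrow> drop k (daw i n) = daw (i + k) (n - k)"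
  by (simp add: daw_def drop_map)

text \<open>Modulo 4 this is the reflection taking k to 1 - k, which swaps 0 with 1 and 2 with
  3.\<close>

lemma cyc_reflect: "cyc (3 * k + 1) = cyc k"
proof -
  have "(3 * k + 1) mod 4 = (3 * (k mod 4) + 1) mod 4"
    by (intro mod_add_cong mod_mult_cong) simp_all
  moreover have "k mod 4 \<in> {0, 1, 2, 3}" by auto
  ultimately have "(3 * k + 1) mod 4 < 2 \<longleftrightarrow> k mod 4 < 2" by auto
  then show ?thesis by (simp add: cyc_def)
qed

text \<open>The start is the reflection of the last position: 1 - (i + n - 1) modulo 4.\<close>

lemma rev_daw: "rev (daw i n) = daw (3 * i + 3 * n + 2) n"
proof (rule nth_equalityI)
  fix m assume "m < length (rev (daw i n))"
  then have m: "m < n" by simp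
  have "rev (daw i n) ! m = cyc (i + (n - Suc m))"
    using m by (simp add: rev_nth nth_daw)
  also have "\<dots> = cyc (3 * (i + (n - Suc m)) + 1)" by (simp only: cyc_reflect)
  also have "\<dots> = cyc (3 * i + 3 * n + 2 + m)"
  proof (rule cyc_cong)
    obtain d where d: "n = Suc m + d" using m less_iff_Suc_add by auto
    have "3 * i + 3 * n + 2 + m = 3 * (i + (n - Suc m)) + 1 + 4 * Suc m"
      unfolding d by simp
    then show "(3 * (i + (n - Suc m)) + 1) mod 4 = (3 * i + 3 * n + 2 + m) mod 4"
      by (simp only: mod_mult_self2)
  qed
  also have "\<dots> = daw (3 * i + 3 * n + 2) n ! m" using m by (simp only: nth_daw)
  finally show "rev (daw i n) ! m = daw (3 * i + 3 * n + 2) n ! m" .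
qed simp

text \<open>Modulo 4, \<open>i + 3\<close> is the position before \<open>i\<close>. The level is 1
  just before a block \<open>cc\<close>, -1 just after it and 0 inside any block.\<close>

definition level :: "letter \<Rightarrow> nat \<Rightarrow> int" where
  "level c i = (if cyc i = c then 1 else 0) - (if cyc (i + 3) = c then 1 else 0)"

lemma cyc_step: "cyc (Suc (Suc i)) = (if cyc i = X then Y else X)"
proof -
  have "Suc (Suc i) mod 4 < 2 \<longleftrightarrow> \<not> i mod 4 < 2" by presburger
  then show ?thesis by (simp add: cyc_def)
qed

lemma cyc_3: "cyc (i + 3) = (if cyc (Suc i) = X then Y else X)"
  using cyc_step[of "Suc i"] by (simp add: numeral_3_eq_3)

lemma cyc_Suc_3: "cyc (Suc i + 3) = cyc i"
  by (rule cyc_cong) simp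

text \<open>Letters two positions apart differ, so \<open>level\<close> is a potential for the
  pairing and sums of pairings telescope.\<close>

lemma level_Suc: "2 * level c (Suc i) = 2 * level c i - pairing c (cyc i)"
  unfolding level_def cyc_Suc_3 cyc_3
  by (cases c; cases "cyc i"; cases "cyc (Suc i)") (simp_all add: cyc_step)

lemma pairing_sum_daw: "(\<Sum>a\<leftarrow>daw i n. pairing c a) = 2 * level c i - 2 * level c (i + n)"
proof (induction n arbitrary: i)
  case (Suc n)
  then show ?case using level_Suc[of c i] by (simp add: daw_Suc)
qed simp

text \<open>
  Inserting \<open>c\<close> at cyclic position \<open>j\<close> gets the coefficient \<open>q\<^bsup>2l\<^esup> - q\<^bsup>-2l\<^esup>\<close> with \<open>l = level c j\<close>. By
  \<open>pairing_sum_daw\<close>, the weight \<open>level c (i + n)\<close> is \<open>level c i\<close> corrected by the total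
  pairing of \<open>c\<close> with the word.
\<close>

lemma insertion_daw:
  fixes q :: "'a::field"
  assumes q: "q \<noteq> 0"
  shows "scale (q powi (2 * level c (i + n))) (qshuffle_words q (daw i n) [c]) -
      scale (q powi (- 2 * level c i)) (qshuffle_words q [c] (daw i n)) =
    scale (q powi 2 - q powi (-2))
      ((if cyc (i + n) = c then word (daw i n @ [c]) else 0) -
       (if cyc (i + 3) = c then word (c # daw i n) else 0))"
proof (induction n arbitrary: i)
  case 0
  show ?case
    by (auto simp: level_def tensor.scale_left_diff_distrib tensor.scale_minus_left)
next
  case (Suc n)
  let ?a = "cyc i" and ?w = "daw (Suc i) n" and ?d = "q powi 2 - q powi (-2)"
  let ?R = "qshuffle_words q ?w [c]" and ?L = "qshuffle_words q [c] ?w"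
  let ?l = "level c i" and ?m = "level c (i + Suc n)"
  let ?right = "if cyc (i + Suc n) = c then word (daw i (Suc n) @ [c]) else (0::'a tensor)"
  have w: "daw i (Suc n) = ?a # ?w" by (rule daw_Suc)
  have sum: "(\<Sum>b\<leftarrow>?a # ?w. pairing c b) = 2 * ?l - 2 * ?m"
    using pairing_sum_daw[of c i "Suc n"] by (simp only: w)
  have R: "qshuffle_words q (?a # ?w) [c] =
      prepend ?a ?R + scale (q powi (2 * ?l - 2 * ?m)) (word (c # ?a # ?w))"
    by (simp only: qshuffle_words_Cons_Cons sum) simp
  have L: "qshuffle_words q [c] (?a # ?w) =
      word (c # ?a # ?w) + scale (q powi pairing c ?a) (prepend ?a ?L)"
    by (simp add: qshuffle_words_Cons_Cons pairing_commute)
  have lev: "- 2 * ?l + pairing c ?a = - 2 * level c (Suc i)"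
    using level_Suc[of c i] by simp
  have "scale (q powi (2 * ?m)) (qshuffle_words q (?a # ?w) [c]) -
      scale (q powi (- 2 * ?l)) (qshuffle_words q [c] (?a # ?w)) =
    prepend ?a (scale (q powi (2 * ?m)) ?R - scale (q powi (- 2 * level c (Suc i))) ?L) +
    scale (q powi (2 * ?l) - q powi (- 2 * ?l)) (word (c # ?a # ?w))"
    unfolding R L lev[symmetric] using q
    by (simp add: tensor.scale_right_distrib tensor.scale_left_diff_distrib
        flip: power_int_add)
  also have "\<dots> = scale ?d (?right -
        (if cyc (Suc i + 3) = c then word (?a # c # ?w) else 0)) +
      scale (q powi (2 * ?l) - q powi (- 2 * ?l)) (word (c # ?a # ?w))"
    using Suc.IH[of "Suc i"] by (simp add: w)
  \<comment> \<open>If \<open>?a\<close> is \<open>c\<close>, the two insertions around it give the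
    same word: they cancel at level 1, and at level 0 the old left end term becomes the new one.
    Otherwise level -1 supplies the new term.\<close>
  also have "\<dots> = scale ?d (?right - (if cyc (i + 3) = c then word (c # ?a # ?w) else 0))"
    unfolding cyc_Suc_3
    by (auto simp: level_def tensor.scale_left_diff_distrib tensor.scale_right_diff_distrib)
  finally show ?case by (simp only: w)
qed

section \<open>Membership in the subalgebra\<close>

lemma letter_in_U: "word [c] \<in> U q"
  by (cases c) (auto intro: U.gen_x U.gen_y)

lemma power_int_eq_1_imp_0:
  fixes q :: "'a::field"
  assumes "\<And>m::nat. m > 0 \<Longrightarrow> q ^ m \<noteq> 1" "q powi k = 1"
  shows "k = 0"
proof (rule ccontr)
  assume "k \<noteq> 0"
  then have "nat \<bar>k\<bar> > 0" by simp
  moreover have "q ^ nat \<bar>k\<bar> = 1"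
    using assms(2) by (auto simp: power_int_def abs_if power_inverse split: if_splits)
  ultimately show False using assms(1) by blast
qed

context
  fixes q :: "'a::field_char_0"
  assumes q0: "q \<noteq> 0" and not_root: "\<And>m::nat. m > 0 \<Longrightarrow> q ^ m \<noteq> 1"
begin

lemma q2_diff_nonzero: "q powi 2 - q powi (-2) \<noteq> 0"
proof
  assume "q powi 2 - q powi (-2) = 0"
  then have "q powi 2 * q powi 2 = q powi (-2) * q powi 2"
    by simp
  then have "q powi 4 = 1"
    using q0 by (simp add: power_int_minus flip: power_add)
  then show False using power_int_eq_1_imp_0[OF not_root, of 4] by simp
qed

text \<open>If \<open>q powi c\<close> were -1, its square would force c = 0, and then 1 = -1,
  against characteristic zero.\<close>

lemma one_plus_powi_nonzero: "1 + q powi c \<noteq> 0"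
proof
  assume "1 + q powi c = 0"
  then have c: "q powi c = - 1" by (simp add: eq_neg_iff_add_eq_0 add.commute)
  then have "q powi (c * 2) = 1" by (simp only: power_int_mult) simp
  then have "c = 0" using power_int_eq_1_imp_0[OF not_root] by force
  with c show False by simp
qed

text \<open>Both products with \<open>c\<close> lie in \<open>U q\<close>, and the scalar in
  \<open>insertion_daw\<close> is invertible.\<close>

lemma extension_in_U:
  assumes "word (daw i n) \<in> U q"
  shows "(if cyc (i + n) = c then word (daw i n @ [c]) else 0) -
    (if cyc (i + 3) = c then word (c # daw i n) else 0) \<in> U q"
proof (rule U_scale_cancel[OF _ q2_diff_nonzero])
  have "qshuffle_words q (daw i n) [c] \<in> U q" "qshuffle_words q [c] (daw i n) \<in> U q"
    using U.mult[OF assms letter_in_U] U.mult[OF letter_in_U assms] by simp_all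
  then show "scale (q powi 2 - q powi (-2))
    ((if cyc (i + n) = c then word (daw i n @ [c]) else 0) -
     (if cyc (i + 3) = c then word (c # daw i n) else 0)) \<in> U q"
    by (subst insertion_daw[OF q0, symmetric]) (intro U_diff U.scale)
qed

lemma daw_Cons_left: "cyc (i + 3) # daw i n = daw (i + 3) (Suc n)"
  using daw_Suc[of "i + 3" n] daw_cong[of "Suc (i + 3)" i n] by simp

lemma extension_right_in_U:
  assumes "word (daw i n) \<in> U q" "cyc (i + n) \<noteq> cyc (i + 3)"
  shows "word (daw i (Suc n)) \<in> U q"
  using extension_in_U[OF assms(1), of "cyc (i + n)"] assms(2) by (simp add: daw_Suc_right)

lemma extension_left_in_U:
  assumes "word (daw (Suc i) n) \<in> U q" "cyc (Suc i + n) \<noteq> cyc i"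
  shows "word (daw i (Suc n)) \<in> U q"
proof -
  have "0 - word (daw i (Suc n)) \<in> U q"
    using extension_in_U[OF assms(1), of "cyc i", unfolded cyc_Suc_3] assms(2)
    by (simp add: daw_Suc)
  then show ?thesis using U_diff[OF U_0] by fastforce
qed

lemma extension_diff_in_U:
  assumes "word (daw i n) \<in> U q" "cyc (i + n) = cyc (i + 3)"
  shows "word (daw i (Suc n)) - word (daw (i + 3) (Suc n)) \<in> U q"
  using extension_in_U[OF assms(1), of "cyc (i + n)"]
  by (simp add: assms(2) daw_Suc_right[of i] daw_Cons_left[symmetric])

lemma daw_in_U: "word (daw i n) \<in> U q"
proof (induction n arbitrary: i rule: less_induct)
  case (less n)
  show ?case
  proof (cases n)
    case 0
    then show ?thesis by (simp add: U.one)
  next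
    case (Suc m)
    then have IH: "word (daw j m) \<in> U q" for j using less.IH by simp
    show ?thesis
    proof (cases "m mod 4 = 3")
      case False
      \<comment> \<open>The word of length \<open>n\<close> extends \<open>daw i m\<close> on the
        right or \<open>daw (Suc i) m\<close> on the left; in one of these cases the other end
        admits no insertion of the same letter.\<close>
      have "cyc (i + m) \<noteq> cyc (i + 3) \<or> cyc (Suc i + m) \<noteq> cyc i"
      proof -
        have shift: "cyc (j + m) = cyc (j + m mod 4)" for j
          by (rule cyc_cong) (simp add: mod_simps)
        have "m mod 4 = 0 \<or> m mod 4 = 1 \<or> m mod 4 = 2" using False by linarith
        then show ?thesis
          unfolding shift cyc_3
          by (cases "cyc i"; cases "cyc (Suc i)") (auto simp: cyc_step)
      qed
      then show ?thesis
        using extension_right_in_U extension_left_in_U IH Suc by blast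
    next
      case True
      \<comment> \<open>Here both ends admit the same letter. Steps of 3, that is -1 modulo 4, reach
        every starting position.\<close>
      have step: "word (daw j n) - word (daw (j + 3) n) \<in> U q" for j
        unfolding Suc by (intro extension_diff_in_U IH cyc_cong mod_add_cong) (simp_all add: True)
      have cong: "word (daw i n) - word (daw (i + 3 * k) n) \<in> U q" for k
      proof (induction k)
        case 0
        then show ?case by (simp add: U_0)
      next
        case (Suc k)
        show ?case using U.add[OF Suc step[of "i + 3 * k"]] by (simp add: algebra_simps)
      qed
      have "word (rev (take k (daw i n))) \<in> U q \<and> word (drop k (daw i n)) \<in> U q"
        if "0 < k" "k < length (daw i n)" for k
        using that by (simp add: take_daw drop_daw rev_daw less.IH)
      moreover have "even (length (daw i n))" using True Suc by simp presburger
      moreover have "daw i n \<noteq> []" using Suc by (simp add: daw_Suc)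
      ultimately obtain c :: int where
        c: "word (daw i n) + scale (q powi c) (word (rev (daw i n))) \<in> U q"
        using word_plus_rev_in_U[OF q0] by blast
      \<comment> \<open>This is the shift from \<open>i\<close> to the start of the reversal. As 9
        is 1 modulo 4, \<open>3 * k\<close> steps of length 3 realize it.\<close>
      define k where "k = 2 * i + 3 * n + 2"
      have "i + 3 * (3 * k) = 3 * i + 3 * n + 2 + 4 * (4 * i + 6 * n + 4)"
        by (simp add: k_def)
      then have "rev (daw i n) = daw (i + 3 * (3 * k)) n"
        unfolding rev_daw by (intro daw_cong) (simp only: mod_mult_self2)
      then have "word (daw i n) + scale (q powi c) (word (rev (daw i n))) +
          scale (q powi c) (word (daw i n) - word (rev (daw i n))) \<in> U q"
        using cong[of "3 * k"] by (intro U.add U.scale c) simp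
      then have "scale (1 + q powi c) (word (daw i n)) \<in> U q"
        by (simp add: tensor.scale_left_distrib tensor.scale_right_diff_distrib)
      then show ?thesis using U_scale_cancel one_plus_powi_nonzero by blast
    qed
  qed
qed

end

section \<open>The words of the theorem and their relations\<close>

lemma daw_append: "daw i (m + n) = daw i m @ daw (i + m) n"
  by (induction m arbitrary: i) (simp_all add: daw_Suc)

lemma daw_4: "daw i (4 + n) = daw i 4 @ daw i n"
  unfolding daw_append by (simp add: daw_cong[of "i + 4" i])

lemma xxyy_eq_daw: "xxyy n = daw 0 (4 * n)"
proof (induction n)
  case (Suc n)
  have "daw 0 4 = [X, X, Y, Y]" by (simp add: daw_def upt_rec cyc_def)
  then show ?case using Suc daw_4[of 0 "4 * n"] by (simp add: xxyy_def)
qed (simp add: xxyy_def)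

lemma yyxx_eq_daw: "yyxx n = daw 2 (4 * n)"
proof (induction n)
  case (Suc n)
  have "daw 2 4 = [Y, Y, X, X]" by (simp add: daw_def upt_rec cyc_def)
  then show ?case using Suc daw_4[of 2 "4 * n"] by (simp add: yyxx_def)
qed (simp add: yyxx_def)

theorem proposition4p1:
  fixes q :: "'a::field_char_0" and n :: nat
  assumes "q \<noteq> 0"
    and "\<And>m::nat. m > 0 \<Longrightarrow> q ^ m \<noteq> 1"
  shows
    "{word [X], word (xxyy n), word (xxyy n @ [X]), word (yyxx n), word ([X] @ yyxx n),
      word (xxyy n @ [X, X]), word (yyxx n @ [Y, Y]), word (yyxx n @ [Y, Y, X]),
      word ([X, Y, Y] @ xxyy n)} \<subseteq> U q \<and>
     qcomm q (q ^ 2) (word (xxyy n)) (word [X]) =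
       scale (q ^ 2 - q powi (-2)) (word (xxyy n @ [X])) \<and>
     qcomm q (q ^ 2) (word [X]) (word (yyxx n)) =
       scale (q ^ 2 - q powi (-2)) (word ([X] @ yyxx n)) \<and>
     comm q (word [X]) (word (xxyy n @ [X, X])) = 0 \<and>
     comm q (word (yyxx n @ [Y, Y])) (word [X]) =
       scale (1 - q powi (-4)) (word (yyxx n @ [Y, Y, X]) - word ([X, Y, Y] @ xxyy n))"
proof -
  have daw_small: "daw 0 1 = [X]" "daw 0 2 = [X, X]" "daw 1 1 = [X]" "daw 2 2 = [Y, Y]"
    "daw 2 3 = [Y, Y, X]" "daw 1 3 = [X, Y, Y]"
    by (simp_all add: daw_def cyc_def upt_rec)
  have shift: "daw (k + 4 * n) m = daw k m" for k m
    by (rule daw_cong) simp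
  have right: "daw k (m + 4 * n) = daw k (4 * n) @ daw k m" for k m
    using daw_append[of k "4 * n" m] by (simp add: shift add.commute[of m])
  have words: "xxyy n @ [X] = daw 0 (1 + 4 * n)"
    "xxyy n @ [X, X] = daw 0 (2 + 4 * n)" "yyxx n @ [Y, Y] = daw 2 (2 + 4 * n)"
    "yyxx n @ [Y, Y, X] = daw 2 (3 + 4 * n)"
    by (simp_all only: xxyy_eq_daw yyxx_eq_daw right daw_small)
  \<comment> \<open>A single leading \<open>X\<close> followed by \<open>Y\<close> is the second
    letter of its block, hence the start 1.\<close>
  have words': "[X] @ yyxx n = daw 1 (1 + 4 * n)" "[X, Y, Y] @ xxyy n = daw 1 (3 + 4 * n)"
    using daw_append[of 1 1 "4 * n"] daw_append[of 1 3 "4 * n"] daw_cong[of 4 0 "4 * n"]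
    by (simp_all add: daw_small xxyy_eq_daw yyxx_eq_daw del: One_nat_def)
  have cyc4: "cyc (k + 4 * n) = cyc k" for k
    by (rule cyc_cong) simp
  have lev4: "level X (k + 4 * n) = level X k" for k
    unfolding level_def add.commute[of "k + 4 * n" 3] add.assoc[symmetric] cyc4
    by (simp add: add.commute)
  have lev: "level X (0 + 4 * n) = 1" "level X 0 = 1" "level X 2 = -1" "level X (2 + 4 * n) = -1"
    "level X (4 + 4 * n) = 1" "cyc (0 + 4 * n) = X" "cyc (0 + 3) = Y" "cyc (2 + 4 * n) = Y"
    "cyc (2 + 3) = X" "cyc (4 + 4 * n) = X"
    by (simp_all only: lev4 cyc4) (simp_all add: level_def cyc_def)
  note in_U = daw_in_U[OF assms]
  note rel = insertion_daw[OF assms(1), where c = X]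
  \<comment> \<open>Equal levels at both ends produce a \<open>q^2\<close>-commutator: level 1 here,
    level -1, with the sign reversed, in the next relation.\<close>
  have "qcomm q (q ^ 2) (word (xxyy n)) (word [X]) =
      scale (q ^ 2 - q powi (-2)) (word (xxyy n @ [X]))"
    using rel[of 0 "4 * n", unfolded lev] by (simp add: qcomm_def xxyy_eq_daw power_int_minus)
  moreover have "qcomm q (q ^ 2) (word [X]) (word (yyxx n)) =
      scale (q ^ 2 - q powi (-2)) (word ([X] @ yyxx n))"
    using arg_cong[OF rel[of 2 "4 * n", unfolded lev], of uminus]
    by (simp add: qcomm_def yyxx_eq_daw power_int_minus)
  moreover have "comm q (word [X]) (word (xxyy n @ [X, X])) = 0"
  proof -
    \<comment> \<open>Opposite levels at the ends give equal weights, hence a commutator. Both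
      neighbours of this word in the cyclic pattern are \<open>Y\<close>, so no insertion
      survives.\<close>
    have "scale (q powi (-2)) (comm q (word (daw 0 (2 + 4 * n))) (word [X])) = 0"
      using rel[of 0 "2 + 4 * n", unfolded add_0[of "2 + 4 * n"] lev]
      by (simp add: comm_def tensor.scale_right_diff_distrib)
    then show ?thesis using assms(1) by (simp add: comm_def words)
  qed
  moreover have "comm q (word (yyxx n @ [Y, Y])) (word [X]) =
      scale (1 - q powi (-4)) (word (yyxx n @ [Y, Y, X]) - word ([X, Y, Y] @ xxyy n))"
  proof -
    have three: "3 + 4 * n = 1 + (2 + 4 * n)" by simp
    have "yyxx n @ [Y, Y, X] = (yyxx n @ [Y, Y]) @ [X]" by simp
    then have ends: "yyxx n @ [Y, Y, X] = daw 2 (2 + 4 * n) @ [X]"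
      "[X, Y, Y] @ xxyy n = X # daw 2 (2 + 4 * n)"
      unfolding words(3) words'(2) three daw_append[of 1 1] daw_small one_add_one by simp_all
    have total: "2 + (2 + 4 * n) = 4 + 4 * n" by simp
    \<comment> \<open>Here both neighbours are \<open>X\<close>, so both end insertions survive;
      cancelling the common weight leaves the factor \<open>1 - q powi (-4)\<close>.\<close>
    have "scale (q powi 2) (comm q (word (yyxx n @ [Y, Y])) (word [X])) =
        scale (q powi 2 - q powi (-2)) (word (yyxx n @ [Y, Y, X]) - word ([X, Y, Y] @ xxyy n))"
      unfolding ends words(3) using rel[of 2 "2 + 4 * n", unfolded total lev]
      by (simp add: comm_def tensor.scale_right_diff_distrib)
    also have "q powi 2 - q powi (-2) = q powi 2 * (1 - q powi (-4))"
      using assms(1) power_int_add[of q 2 "-4"] by (simp add: right_diff_distrib)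
    finally have "scale (q powi 2) (comm q (word (yyxx n @ [Y, Y])) (word [X])) =
        scale (q powi 2) (scale (1 - q powi (-4))
          (word (yyxx n @ [Y, Y, X]) - word ([X, Y, Y] @ xxyy n)))"
      by (simp only: tensor.scale_scale)
    then show ?thesis
      using assms(1) by (simp only: tensor.scale_cancel_left) simp
  qed
  ultimately show ?thesis
    using in_U by (simp only: words words') (simp add: xxyy_eq_daw yyxx_eq_daw letter_in_U)
qed

end
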